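(* Every $g\in B_3$ can be written uniquely in the form $g=\Delta^{k}\prod_{i=1}^{n}\sigma_1^{a_i}\sigma_2^{b_i}$, where $k$ is an integer, $n\ge 1$, the exponents $a_i,b_i$ are integers, $a_1\geq 0$, $b_n\in\mathbb{Z}$ is arbitrary, $a_i>0$ for $2\leq i\leq n$, and $b_i<0$ for $1\leq i\leq n-1$.
   Context: The braid group $B_3$ is given by the Artin presentation $B_3=\langle \sigma_1,\sigma_2 : \sigma_1\sigma_2\sigma_1=\sigma_2\sigma_1\sigma_2\rangle$, and $\Delta=\sigma_1\sigma_2\sigma_1$ is its Garside element. The product $\prod_{i=1}^n\sigma_1^{a_i}\sigma_2^{b_i}$ denotes $\sigma_1^{a_1}\sigma_2^{b_1}\sigma_1^{a_2}\sigma_2^{b_2}\cdots\sigma_1^{a_n}\sigma_2^{b_n}$. Uniqueness means that the data $k$, $n$, $(a_i)_{1\le i\le n}$, $(b_i)_{1\le i\le n}$ are determined by $g$. *)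

theory Defs
  imports "HOL-Algebra.Group"
begin

section \<open>Groups given by generators and relations\<close>

text \<open>
  The letter \<open>(x, True)\<close> stands for the generator \<open>x\<close> and \<open>(x, False)\<close> for its inverse.
  A pair \<open>(u, v) \<in> R\<close> is the relation \<open>u = v\<close>.
\<close>

type_synonym 'a word = "('a \<times> bool) list"

inductive pres_eq :: "('a word \<times> 'a word) set \<Rightarrow> 'a word \<Rightarrow> 'a word \<Rightarrow> bool"
  for R :: "('a word \<times> 'a word) set" where
  relation: "(u, v) \<in> R \<Longrightarrow> pres_eq R u v"
| cancel: "pres_eq R [(x, e), (x, \<not> e)] []"
| append: "pres_eq R u u' \<Longrightarrow> pres_eq R v v' \<Longrightarrow> pres_eq R (u @ v) (u' @ v')"
| refl: "pres_eq R u u"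
| sym: "pres_eq R u v \<Longrightarrow> pres_eq R v u"
| trans: "pres_eq R u v \<Longrightarrow> pres_eq R v w \<Longrightarrow> pres_eq R u w"

definition word_class :: "('a word \<times> 'a word) set \<Rightarrow> 'a word \<Rightarrow> 'a word set" where
  "word_class R u = {v. pres_eq R u v}"

definition presented_group :: "('a word \<times> 'a word) set \<Rightarrow> 'a word set monoid" where
  "presented_group R =
    \<lparr>carrier = range (word_class R),
     mult = (\<lambda>A B. \<Union>u\<in>A. \<Union>v\<in>B. word_class R (u @ v)),
     one = word_class R []\<rparr>"

lemma word_class_eq_iff: "word_class R u = word_class R v \<longleftrightarrow> pres_eq R u v"
proof
  assume "word_class R u = word_class R v"
  then have "v \<in> word_class R u" by (simp add: word_class_def pres_eq.refl)
  then show "pres_eq R u v" by (simp add: word_class_def)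
next
  assume uv: "pres_eq R u v"
  then have "pres_eq R u w \<longleftrightarrow> pres_eq R v w" for w
    using pres_eq.trans[OF uv] pres_eq.trans[OF pres_eq.sym[OF uv]] by blast
  then show "word_class R u = word_class R v" by (simp add: word_class_def)
qed

lemma mult_word_class:
  "word_class R u \<otimes>\<^bsub>presented_group R\<^esub> word_class R v = word_class R (u @ v)"
proof -
  have eq: "word_class R (u' @ v') = word_class R (u @ v)"
    if "u' \<in> word_class R u" "v' \<in> word_class R v" for u' v'
    using that unfolding word_class_eq_iff
    by (simp add: word_class_def pres_eq.append[THEN pres_eq.sym])
  have "u \<in> word_class R u" "v \<in> word_class R v"
    by (simp_all add: word_class_def pres_eq.refl)
  then have "(\<Union>u'\<in>word_class R u. \<Union>v'\<in>word_class R v. word_class R (u' @ v')) =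
      word_class R (u @ v)"
    by (intro subset_antisym UN_least equalityD1[OF eq] SUP_upper2[of u] SUP_upper2[of v]
        order_refl)
  then show ?thesis
    by (simp add: presented_group_def)
qed

lemma pres_eq_inverse: "pres_eq R (map (\<lambda>(x, e). (x, \<not> e)) (rev u) @ u) []"
proof (induction u)
  case Nil
  show ?case by (simp add: pres_eq.refl)
next
  case (Cons l u)
  obtain x e where l: "l = (x, e)" by (cases l)
  let ?i = "map (\<lambda>(x, e). (x, \<not> e)) (rev u)"
  have "pres_eq R [(x, \<not> e), (x, e)] []"
    using pres_eq.cancel[of R x "\<not> e"] by simp
  then have "pres_eq R (?i @ [(x, \<not> e), (x, e)] @ u) (?i @ [] @ u)"
    by (intro pres_eq.append pres_eq.refl)
  then have "pres_eq R (?i @ [(x, \<not> e), (x, e)] @ u) []"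
    using Cons.IH by (simp add: pres_eq.trans)
  then show ?case
    by (simp add: l)
qed

lemma carrier_presented_group: "carrier (presented_group R) = range (word_class R)"
  by (simp add: presented_group_def)

lemma group_presented_group: "group (presented_group R)"
proof (rule groupI)
  fix A B C
  assume "A \<in> carrier (presented_group R)" "B \<in> carrier (presented_group R)"
    "C \<in> carrier (presented_group R)"
  then show "A \<otimes>\<^bsub>presented_group R\<^esub> B \<otimes>\<^bsub>presented_group R\<^esub> C =
      A \<otimes>\<^bsub>presented_group R\<^esub> (B \<otimes>\<^bsub>presented_group R\<^esub> C)"
    by (auto simp: carrier_presented_group mult_word_class)
next
  fix A assume "A \<in> carrier (presented_group R)"
  then obtain u where u: "A = word_class R u" by (auto simp: presented_group_def)
  have one: "\<one>\<^bsub>presented_group R\<^esub> = word_class R []" by (simp add: presented_group_def)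
  show "\<one>\<^bsub>presented_group R\<^esub> \<otimes>\<^bsub>presented_group R\<^esub> A = A"
    by (simp add: u one mult_word_class)
  have "word_class R (map (\<lambda>(x, e). (x, \<not> e)) (rev u)) \<otimes>\<^bsub>presented_group R\<^esub> A =
      \<one>\<^bsub>presented_group R\<^esub>"
    unfolding u one mult_word_class word_class_eq_iff by (rule pres_eq_inverse)
  moreover have "word_class R (map (\<lambda>(x, e). (x, \<not> e)) (rev u)) \<in> carrier (presented_group R)"
    by (simp add: presented_group_def)
  ultimately show "\<exists>B\<in>carrier (presented_group R).
      B \<otimes>\<^bsub>presented_group R\<^esub> A = \<one>\<^bsub>presented_group R\<^esub>" by blast
next
  fix A B
  assume "A \<in> carrier (presented_group R)" "B \<in> carrier (presented_group R)"
  then show "A \<otimes>\<^bsub>presented_group R\<^esub> B \<in> carrier (presented_group R)"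
    by (auto simp: carrier_presented_group mult_word_class)
qed (simp add: presented_group_def)


section \<open>The braid group on three strands\<close>

datatype artin_gen = S1 | S2

definition braid_relations :: "(artin_gen word \<times> artin_gen word) set" where
  "braid_relations =
    {([(S1, True), (S2, True), (S1, True)], [(S2, True), (S1, True), (S2, True)])}"

definition B3 :: "artin_gen word set monoid" where
  "B3 = presented_group braid_relations"

lemma group_B3: "group B3"
  unfolding B3_def by (rule group_presented_group)

definition sigma1 :: "artin_gen word set" ("\<sigma>\<^sub>1") where
  "\<sigma>\<^sub>1 = word_class braid_relations [(S1, True)]"

definition sigma2 :: "artin_gen word set" ("\<sigma>\<^sub>2") where
  "\<sigma>\<^sub>2 = word_class braid_relations [(S2, True)]"

lemma sigma_in_B3: "\<sigma>\<^sub>1 \<in> carrier B3" "\<sigma>\<^sub>2 \<in> carrier B3"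
  by (simp_all add: B3_def presented_group_def sigma1_def sigma2_def)

lemma braid_relation:
  "\<sigma>\<^sub>1 \<otimes>\<^bsub>B3\<^esub> \<sigma>\<^sub>2 \<otimes>\<^bsub>B3\<^esub> \<sigma>\<^sub>1 = \<sigma>\<^sub>2 \<otimes>\<^bsub>B3\<^esub> \<sigma>\<^sub>1 \<otimes>\<^bsub>B3\<^esub> \<sigma>\<^sub>2"
  unfolding B3_def sigma1_def sigma2_def mult_word_class word_class_eq_iff
  by (simp add: braid_relations_def pres_eq.relation)

definition Garside :: "artin_gen word set" ("\<Delta>") where
  "\<Delta> = \<sigma>\<^sub>1 \<otimes>\<^bsub>B3\<^esub> \<sigma>\<^sub>2 \<otimes>\<^bsub>B3\<^esub> \<sigma>\<^sub>1"

primrec alternating_product :: "(nat \<Rightarrow> int) \<Rightarrow> (nat \<Rightarrow> int) \<Rightarrow> nat \<Rightarrow> artin_gen word set" where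
  "alternating_product a b 0 = \<one>\<^bsub>B3\<^esub>"
| "alternating_product a b (Suc n) =
    alternating_product a b n \<otimes>\<^bsub>B3\<^esub>
      (\<sigma>\<^sub>1 [^]\<^bsub>B3\<^esub> a (Suc n) \<otimes>\<^bsub>B3\<^esub> \<sigma>\<^sub>2 [^]\<^bsub>B3\<^esub> b (Suc n))"

text \<open>
  Only the values of \<open>a\<close> and \<open>b\<close> on \<open>{1..n}\<close> matter.
\<close>

definition normal_form ::
  "artin_gen word set \<Rightarrow> int \<Rightarrow> nat \<Rightarrow> (nat \<Rightarrow> int) \<Rightarrow> (nat \<Rightarrow> int) \<Rightarrow> bool" where
  "normal_form g k n a b \<longleftrightarrow>
    n \<ge> 1 \<and> a 1 \<ge> 0 \<and> (\<forall>i\<in>{2..n}. a i > 0) \<and> (\<forall>i\<in>{1..n - 1}. b i < 0) \<and>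
    g = \<Delta> [^]\<^bsub>B3\<^esub> k \<otimes>\<^bsub>B3\<^esub> alternating_product a b n"

end

(*
  Existence: let X (the set cone) consist of the elements W sigma2^b, where W lies in the monoid
  generated by sigma1 and sigma2^-1.  Since sigma2 sigma1 = Delta sigma2^-1 and
  sigma1^-1 = Delta^-1 sigma1 sigma2, and since conjugation by Delta exchanges the generators,
  the elements Delta^k x with x in X are stable under left multiplication by the generators and
  their inverses.

  Uniqueness: B3 acts on Z^2 through SL2(Z), with Delta acting as a rotation by a right angle and
  sigma2 fixing (0,1).  The alternating products map (0,1) into the quadrant x >= 0, y > 0, which is
  a fundamental domain for the rotation; this determines k modulo 4.  A Euclidean algorithm
  on the image of (0,1) recovers the exponents, the last one being read off the image of (1,0).
  The exponent sum then determines k.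
*)

theory Submission
  imports Defs
begin

interpretation B3: group B3
  by (rule group_B3)

declare sigma_in_B3 [simp]

lemma Garside_in_B3 [simp]: "\<Delta> \<in> carrier B3"
  by (simp add: Garside_def)


section \<open>Alternating products as lists of exponent pairs\<close>

text \<open>The recursion peels off the first pair, whereas \<open>alternating_product\<close> grows
  at its end: existence multiplies from the left, and the Euclidean algorithm recovers the first
  exponents first.\<close>

primrec list_product :: "(int \<times> int) list \<Rightarrow> artin_gen word set" where
  "list_product [] = \<one>\<^bsub>B3\<^esub>"
| "list_product (p # l) =
    \<sigma>\<^sub>1 [^]\<^bsub>B3\<^esub> fst p \<otimes>\<^bsub>B3\<^esub> (\<sigma>\<^sub>2 [^]\<^bsub>B3\<^esub> snd p \<otimes>\<^bsub>B3\<^esub> list_product l)"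

lemma list_product_in_B3 [simp]: "list_product l \<in> carrier B3"
  by (induction l) auto

lemma list_product_append:
  "list_product (l @ l') = list_product l \<otimes>\<^bsub>B3\<^esub> list_product l'"
  by (induction l) (auto simp: B3.m_assoc)

text \<open>The sign conditions of \<open>normal_form\<close> in list form: \<open>tl\<close> covers
  the indices 2 to n and \<open>butlast\<close> the indices 1 to n - 1.\<close>

definition admissible :: "(int \<times> int) list \<Rightarrow> bool" where
  "admissible l \<longleftrightarrow> l \<noteq> [] \<and> fst (hd l) \<ge> 0 \<and> (\<forall>p\<in>set (tl l). fst p > 0) \<and>
    (\<forall>p\<in>set (butlast l). snd p < 0)"

lemma alternating_product_eq_list_product:
  "alternating_product a b n = list_product (map (\<lambda>i. (a i, b i)) [1..<Suc n])"
  by (induction n) (auto simp: list_product_append)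

lemma normal_form_iff_admissible:
  "normal_form g k n a b \<longleftrightarrow>
    admissible (map (\<lambda>i. (a i, b i)) [1..<Suc n]) \<and>
    g = \<Delta> [^]\<^bsub>B3\<^esub> k \<otimes>\<^bsub>B3\<^esub> list_product (map (\<lambda>i. (a i, b i)) [1..<Suc n])"
proof -
  let ?l = "map (\<lambda>i. (a i, b i)) [1..<Suc n]"
  have "set (tl ?l) = (\<lambda>i. (a i, b i)) ` {2..n}"
    by (auto simp: tl_upt numeral_2_eq_2 simp del: upt_Suc simp flip: map_tl)
  moreover have "set (butlast ?l) = (\<lambda>i. (a i, b i)) ` {1..n - 1}"
    by (cases n) (auto simp: map_butlast)
  moreover have "fst (hd ?l) = a 1" if "n \<ge> 1"
    using that by (simp add: hd_map del: upt_Suc)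
  ultimately show ?thesis
    unfolding normal_form_def admissible_def alternating_product_eq_list_product
    by (cases "n \<ge> 1") (simp_all del: upt_Suc)
qed


section \<open>Existence\<close>

lemma Garside_eq: "\<Delta> = \<sigma>\<^sub>2 \<otimes>\<^bsub>B3\<^esub> \<sigma>\<^sub>1 \<otimes>\<^bsub>B3\<^esub> \<sigma>\<^sub>2"
  unfolding Garside_def by (rule braid_relation)

text \<open>With Delta written as sigma2 sigma1 sigma2, the left side regroups to (sigma1 sigma2
  sigma1) sigma2.\<close>

lemma sigma1_Garside: "\<sigma>\<^sub>1 \<otimes>\<^bsub>B3\<^esub> \<Delta> = \<Delta> \<otimes>\<^bsub>B3\<^esub> \<sigma>\<^sub>2"
proof -
  have "\<sigma>\<^sub>1 \<otimes>\<^bsub>B3\<^esub> \<Delta> = \<sigma>\<^sub>1 \<otimes>\<^bsub>B3\<^esub> (\<sigma>\<^sub>2 \<otimes>\<^bsub>B3\<^esub> \<sigma>\<^sub>1 \<otimes>\<^bsub>B3\<^esub> \<sigma>\<^sub>2)"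
    by (simp add: Garside_eq)
  also have "\<dots> = \<Delta> \<otimes>\<^bsub>B3\<^esub> \<sigma>\<^sub>2"
    by (simp add: Garside_def B3.m_assoc)
  finally show ?thesis .
qed

lemma sigma2_Garside: "\<sigma>\<^sub>2 \<otimes>\<^bsub>B3\<^esub> \<Delta> = \<Delta> \<otimes>\<^bsub>B3\<^esub> \<sigma>\<^sub>1"
proof -
  have "\<sigma>\<^sub>2 \<otimes>\<^bsub>B3\<^esub> \<Delta> = \<sigma>\<^sub>2 \<otimes>\<^bsub>B3\<^esub> \<sigma>\<^sub>1 \<otimes>\<^bsub>B3\<^esub> \<sigma>\<^sub>2 \<otimes>\<^bsub>B3\<^esub> \<sigma>\<^sub>1"
    by (simp add: Garside_def B3.m_assoc)
  then show ?thesis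
    by (simp add: Garside_eq)
qed


text \<open>Each factor Delta swaps the two generators. Keeping \<open>s'\<close> existential avoids
  tracking the parity of \<open>k\<close>.\<close>

lemma generator_Garside_power:
  assumes "s \<in> {\<sigma>\<^sub>1, \<sigma>\<^sub>2}"
  shows "\<exists>s'\<in>{\<sigma>\<^sub>1, \<sigma>\<^sub>2}. s \<otimes>\<^bsub>B3\<^esub> \<Delta> [^]\<^bsub>B3\<^esub> (k::int) = \<Delta> [^]\<^bsub>B3\<^esub> k \<otimes>\<^bsub>B3\<^esub> s'"
  using assms
proof (induction k arbitrary: s rule: int_induct[where k = 0])
  case base
  then show ?case by auto
next
  case (step1 i)
  have s: "s \<in> carrier B3" using step1.prems by auto
  obtain t where t: "t \<in> {\<sigma>\<^sub>1, \<sigma>\<^sub>2}" "s \<otimes>\<^bsub>B3\<^esub> \<Delta> [^]\<^bsub>B3\<^esub> i = \<Delta> [^]\<^bsub>B3\<^esub> i \<otimes>\<^bsub>B3\<^esub> t"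
    using step1.IH[OF step1.prems] by blast
  obtain u where u: "u \<in> {\<sigma>\<^sub>1, \<sigma>\<^sub>2}" "t \<otimes>\<^bsub>B3\<^esub> \<Delta> = \<Delta> \<otimes>\<^bsub>B3\<^esub> u"
    using t(1) sigma1_Garside sigma2_Garside by auto
  have c: "t \<in> carrier B3" "u \<in> carrier B3"
    using t(1) u(1) by auto
  have "s \<otimes>\<^bsub>B3\<^esub> \<Delta> [^]\<^bsub>B3\<^esub> (i + 1) = s \<otimes>\<^bsub>B3\<^esub> \<Delta> [^]\<^bsub>B3\<^esub> i \<otimes>\<^bsub>B3\<^esub> \<Delta>"
    using s by (simp add: B3.int_pow_mult B3.m_assoc)
  also have "\<dots> = \<Delta> [^]\<^bsub>B3\<^esub> i \<otimes>\<^bsub>B3\<^esub> (t \<otimes>\<^bsub>B3\<^esub> \<Delta>)"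
    using c by (simp add: t(2) B3.m_assoc)
  also have "\<dots> = \<Delta> [^]\<^bsub>B3\<^esub> (i + 1) \<otimes>\<^bsub>B3\<^esub> u"
    using c by (simp add: u(2) B3.int_pow_mult B3.m_assoc)
  finally show ?case using u(1) by blast
next
  case (step2 i)
  have s: "s \<in> carrier B3" using step2.prems by auto
  obtain t where t: "t \<in> {\<sigma>\<^sub>1, \<sigma>\<^sub>2}" "s \<otimes>\<^bsub>B3\<^esub> \<Delta> [^]\<^bsub>B3\<^esub> i = \<Delta> [^]\<^bsub>B3\<^esub> i \<otimes>\<^bsub>B3\<^esub> t"
    using step2.IH[OF step2.prems] by blast
  \<comment> \<open>Going down, the swap is read backwards: \<open>u\<close> is the generator that
    becomes \<open>t\<close> on passing Delta. One factor Delta is then cancelled on the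
    right.\<close>
  obtain u where u: "u \<in> {\<sigma>\<^sub>1, \<sigma>\<^sub>2}" "u \<otimes>\<^bsub>B3\<^esub> \<Delta> = \<Delta> \<otimes>\<^bsub>B3\<^esub> t"
    using t(1) sigma1_Garside sigma2_Garside by auto
  have c: "t \<in> carrier B3" "u \<in> carrier B3"
    using t(1) u(1) by auto
  have split: "\<Delta> [^]\<^bsub>B3\<^esub> (i - 1) \<otimes>\<^bsub>B3\<^esub> \<Delta> = \<Delta> [^]\<^bsub>B3\<^esub> i"
    using B3.int_pow_mult[of \<Delta> "i - 1" 1] by simp
  have "s \<otimes>\<^bsub>B3\<^esub> \<Delta> [^]\<^bsub>B3\<^esub> (i - 1) \<otimes>\<^bsub>B3\<^esub> \<Delta> = s \<otimes>\<^bsub>B3\<^esub> \<Delta> [^]\<^bsub>B3\<^esub> i"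
    using s by (simp add: B3.m_assoc split)
  also have "\<dots> = \<Delta> [^]\<^bsub>B3\<^esub> (i - 1) \<otimes>\<^bsub>B3\<^esub> \<Delta> \<otimes>\<^bsub>B3\<^esub> t"
    unfolding t(2) split ..
  also have "\<dots> = \<Delta> [^]\<^bsub>B3\<^esub> (i - 1) \<otimes>\<^bsub>B3\<^esub> u \<otimes>\<^bsub>B3\<^esub> \<Delta>"
    using c by (simp add: B3.m_assoc flip: u(2))
  finally have "s \<otimes>\<^bsub>B3\<^esub> \<Delta> [^]\<^bsub>B3\<^esub> (i - 1) = \<Delta> [^]\<^bsub>B3\<^esub> (i - 1) \<otimes>\<^bsub>B3\<^esub> u"
    using s c by (simp add: B3.right_cancel)
  then show ?case using u(1) by blast
qed

section \<open>The cone and its Garside translates\<close>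

text \<open>The base rule allows every integer \<open>m\<close>; it supplies the unrestricted last
  exponent of the normal form.\<close>

inductive_set cone :: "artin_gen word set set" where
  power: "\<sigma>\<^sub>2 [^]\<^bsub>B3\<^esub> (m::int) \<in> cone"
| sigma1: "x \<in> cone \<Longrightarrow> \<sigma>\<^sub>1 \<otimes>\<^bsub>B3\<^esub> x \<in> cone"
| inv_sigma2: "x \<in> cone \<Longrightarrow> inv\<^bsub>B3\<^esub> \<sigma>\<^sub>2 \<otimes>\<^bsub>B3\<^esub> x \<in> cone"

lemma cone_in_B3: "x \<in> cone \<Longrightarrow> x \<in> carrier B3"
  by (induction rule: cone.induct) auto

text \<open>A factor sigma1 on the left raises the first exponent. An inverse sigma2 is absorbed by
  the first sigma2-power if the first exponent is 0, and otherwise opens a new pair (0, -1).\<close>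

lemma cone_eq_list_product:
  assumes "x \<in> cone"
  shows "\<exists>l. admissible l \<and> x = list_product l"
  using assms
proof induction
  case (power m)
  show ?case
    by (rule exI[of _ "[(0, m)]"]) (simp add: admissible_def)
next
  case (sigma1 x)
  then obtain l where l: "admissible l" "x = list_product l" by blast
  then obtain a b t where t: "l = (a, b) # t"
    by (metis admissible_def neq_Nil_conv surj_pair)
  have "admissible ((a + 1, b) # t)"
    using l(1) by (auto simp: admissible_def t split: if_splits)
  moreover have "\<sigma>\<^sub>1 \<otimes>\<^bsub>B3\<^esub> x = list_product ((1 + a, b) # t)"
    by (simp add: l(2) t B3.int_pow_mult B3.m_assoc)
  ultimately show ?case by (metis add.commute)
next
  case (inv_sigma2 x)
  then obtain l where l: "admissible l" "x = list_product l" by blast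
  then obtain a b t where t: "l = (a, b) # t"
    by (metis admissible_def neq_Nil_conv surj_pair)
  have pow: "inv\<^bsub>B3\<^esub> \<sigma>\<^sub>2 = \<sigma>\<^sub>2 [^]\<^bsub>B3\<^esub> (-1::int)"
    by (simp add: B3.int_pow_neg)
  show ?case
  proof (cases "a = 0")
    case True
    have "admissible ((0, - 1 + b) # t)"
      using l(1) by (auto simp: admissible_def t split: if_splits)
    moreover have "inv\<^bsub>B3\<^esub> \<sigma>\<^sub>2 \<otimes>\<^bsub>B3\<^esub> x = list_product ((0, - 1 + b) # t)"
      unfolding pow B3.int_pow_mult[OF sigma_in_B3(2)] l(2) t list_product.simps snd_conv fst_conv
      by (simp add: True B3.m_assoc del: B3.int_pow_neg)
    ultimately show ?thesis by blast
  next
    case False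
    \<comment> \<open>The pair \<open>(a, b)\<close> is no longer first, so its first entry must be
      positive; it is, being nonnegative and nonzero.\<close>
    then have "admissible ((0, - 1) # l)"
      using l(1) by (auto simp: admissible_def t)
    moreover have "inv\<^bsub>B3\<^esub> \<sigma>\<^sub>2 \<otimes>\<^bsub>B3\<^esub> x = list_product ((0, - 1) # l)"
      by (simp add: l(2) pow)
    ultimately show ?thesis by blast
  qed
qed

text \<open>This is sigma2 sigma1 = Delta sigma2^-1, from the second expression for Delta; it
  removes a positive sigma2 in front of sigma1.\<close>

lemma sigma2_mult_sigma1:
  assumes "x \<in> carrier B3"
  shows "\<sigma>\<^sub>2 \<otimes>\<^bsub>B3\<^esub> (\<sigma>\<^sub>1 \<otimes>\<^bsub>B3\<^esub> x) = \<Delta> \<otimes>\<^bsub>B3\<^esub> (inv\<^bsub>B3\<^esub> \<sigma>\<^sub>2 \<otimes>\<^bsub>B3\<^esub> x)"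
proof -
  have "\<Delta> \<otimes>\<^bsub>B3\<^esub> (inv\<^bsub>B3\<^esub> \<sigma>\<^sub>2 \<otimes>\<^bsub>B3\<^esub> x) = \<sigma>\<^sub>2 \<otimes>\<^bsub>B3\<^esub> (\<sigma>\<^sub>1 \<otimes>\<^bsub>B3\<^esub> x)"
    using assms by (simp add: Garside_eq B3.m_assoc flip: B3.m_assoc[of _ "inv\<^bsub>B3\<^esub> _"])
  then show ?thesis ..
qed

lemma inv_sigma1_mult:
  assumes "x \<in> carrier B3"
  shows "inv\<^bsub>B3\<^esub> \<sigma>\<^sub>1 \<otimes>\<^bsub>B3\<^esub> x =
    inv\<^bsub>B3\<^esub> \<Delta> \<otimes>\<^bsub>B3\<^esub> (\<sigma>\<^sub>1 \<otimes>\<^bsub>B3\<^esub> (\<sigma>\<^sub>2 \<otimes>\<^bsub>B3\<^esub> x))"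
proof -
  have "\<Delta> \<otimes>\<^bsub>B3\<^esub> (inv\<^bsub>B3\<^esub> \<sigma>\<^sub>1 \<otimes>\<^bsub>B3\<^esub> x) = \<sigma>\<^sub>1 \<otimes>\<^bsub>B3\<^esub> (\<sigma>\<^sub>2 \<otimes>\<^bsub>B3\<^esub> x)"
    using assms by (simp add: Garside_def B3.m_assoc flip: B3.m_assoc[of _ "inv\<^bsub>B3\<^esub> _"])
  then show ?thesis
    using assms by (simp add: B3.inv_solve_left)
qed

text \<open>The elements that existence can reach. Closure under left multiplication by the
  generators and their inverses will show that this is all of \<open>B3\<close>.\<close>

definition Garside_cone :: "artin_gen word set set" where
  "Garside_cone = {\<Delta> [^]\<^bsub>B3\<^esub> (k::int) \<otimes>\<^bsub>B3\<^esub> x |k x. x \<in> cone}"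

lemma Garside_power_mult_Garside_cone:
  assumes "y \<in> Garside_cone"
  shows "\<Delta> [^]\<^bsub>B3\<^esub> (k::int) \<otimes>\<^bsub>B3\<^esub> y \<in> Garside_cone"
proof -
  obtain j x where "y = \<Delta> [^]\<^bsub>B3\<^esub> (j::int) \<otimes>\<^bsub>B3\<^esub> x" "x \<in> cone"
    using assms by (auto simp: Garside_cone_def)
  then have "\<Delta> [^]\<^bsub>B3\<^esub> k \<otimes>\<^bsub>B3\<^esub> y = \<Delta> [^]\<^bsub>B3\<^esub> (k + j) \<otimes>\<^bsub>B3\<^esub> x" "x \<in> cone"
    by (simp_all add: B3.int_pow_mult B3.m_assoc cone_in_B3)
  then show ?thesis
    unfolding Garside_cone_def by blast
qed

lemma cone_subset_Garside_cone: "x \<in> cone \<Longrightarrow> x \<in> Garside_cone"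
  unfolding Garside_cone_def
  by (rule CollectI, rule exI[of _ 0], rule exI[of _ x]) (simp add: cone_in_B3)

text \<open>The leading factor of \<open>x\<close> decides: a power of sigma2 absorbs the new
  factor, sigma1 combines with it into Delta sigma2^-1, and an inverse sigma2 cancels it.\<close>

lemma sigma2_mult_cone:
  assumes "x \<in> cone"
  shows "\<sigma>\<^sub>2 \<otimes>\<^bsub>B3\<^esub> x \<in> Garside_cone"
  using assms
proof cases
  case (power m)
  then have "\<sigma>\<^sub>2 \<otimes>\<^bsub>B3\<^esub> x = \<sigma>\<^sub>2 [^]\<^bsub>B3\<^esub> (1 + m)"
    by (simp add: B3.int_pow_mult)
  then show ?thesis
    by (metis cone.power cone_subset_Garside_cone)
next
  case (sigma1 y)
  then have "\<sigma>\<^sub>2 \<otimes>\<^bsub>B3\<^esub> x = \<Delta> [^]\<^bsub>B3\<^esub> (1::int) \<otimes>\<^bsub>B3\<^esub> (inv\<^bsub>B3\<^esub> \<sigma>\<^sub>2 \<otimes>\<^bsub>B3\<^esub> y)"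
    by (simp add: sigma2_mult_sigma1 cone_in_B3)
  then show ?thesis
    using sigma1 by (metis Garside_power_mult_Garside_cone cone.inv_sigma2 cone_subset_Garside_cone)
next
  case (inv_sigma2 y)
  then have "\<sigma>\<^sub>2 \<otimes>\<^bsub>B3\<^esub> x = y"
    by (simp add: cone_in_B3 flip: B3.m_assoc)
  then show ?thesis
    using inv_sigma2 by (simp add: cone_subset_Garside_cone)
qed

text \<open>Replacing sigma1^-1 by Delta^-1 sigma1 sigma2 works when sigma2 \<open>x\<close> is
  still in the cone, which covers two of the three forms of \<open>x\<close>. A leading sigma1
  simply cancels.\<close>

lemma inv_sigma1_mult_cone:
  assumes "x \<in> cone"
  shows "inv\<^bsub>B3\<^esub> \<sigma>\<^sub>1 \<otimes>\<^bsub>B3\<^esub> x \<in> Garside_cone"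
proof -
  have *: ?thesis if "\<sigma>\<^sub>2 \<otimes>\<^bsub>B3\<^esub> x \<in> cone"
  proof -
    have "inv\<^bsub>B3\<^esub> \<sigma>\<^sub>1 \<otimes>\<^bsub>B3\<^esub> x =
        \<Delta> [^]\<^bsub>B3\<^esub> (-1::int) \<otimes>\<^bsub>B3\<^esub> (\<sigma>\<^sub>1 \<otimes>\<^bsub>B3\<^esub> (\<sigma>\<^sub>2 \<otimes>\<^bsub>B3\<^esub> x))"
      using assms by (simp add: inv_sigma1_mult cone_in_B3 B3.int_pow_neg)
    then show ?thesis
      using that
      by (metis Garside_power_mult_Garside_cone cone.sigma1 cone_subset_Garside_cone)
  qed
  show ?thesis
    using assms
  proof cases
    case (power m)
    then have "\<sigma>\<^sub>2 \<otimes>\<^bsub>B3\<^esub> x = \<sigma>\<^sub>2 [^]\<^bsub>B3\<^esub> (1 + m)"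
      by (simp add: B3.int_pow_mult)
    then show ?thesis
      by (metis * cone.power)
  next
    case (sigma1 y)
    then have "inv\<^bsub>B3\<^esub> \<sigma>\<^sub>1 \<otimes>\<^bsub>B3\<^esub> x = y"
      by (simp add: cone_in_B3 flip: B3.m_assoc)
    then show ?thesis
      using sigma1 by (simp add: cone_subset_Garside_cone)
  next
    case (inv_sigma2 y)
    then have "\<sigma>\<^sub>2 \<otimes>\<^bsub>B3\<^esub> x = y"
      by (simp add: cone_in_B3 flip: B3.m_assoc)
    then show ?thesis
      using inv_sigma2 by (intro *) simp
  qed
qed

lemma generator_mult_Garside_cone:
  assumes s: "s \<in> {\<sigma>\<^sub>1, \<sigma>\<^sub>2}" and y: "y \<in> Garside_cone"
  shows "s \<otimes>\<^bsub>B3\<^esub> y \<in> Garside_cone" "inv\<^bsub>B3\<^esub> s \<otimes>\<^bsub>B3\<^esub> y \<in> Garside_cone"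
proof -
  obtain k x where x: "y = \<Delta> [^]\<^bsub>B3\<^esub> (k::int) \<otimes>\<^bsub>B3\<^esub> x" "x \<in> cone"
    using y by (auto simp: Garside_cone_def)
  \<comment> \<open>Two of these four products stay in the cone by its rules; the other two are the
    preceding lemmas.\<close>
  have cone: "t \<otimes>\<^bsub>B3\<^esub> x \<in> Garside_cone" "inv\<^bsub>B3\<^esub> t \<otimes>\<^bsub>B3\<^esub> x \<in> Garside_cone"
    if "t \<in> {\<sigma>\<^sub>1, \<sigma>\<^sub>2}" for t
    using that x(2)
    by (auto intro: sigma2_mult_cone inv_sigma1_mult_cone cone_subset_Garside_cone cone.intros)
  obtain t where t: "t \<in> {\<sigma>\<^sub>1, \<sigma>\<^sub>2}"
    "s \<otimes>\<^bsub>B3\<^esub> \<Delta> [^]\<^bsub>B3\<^esub> k = \<Delta> [^]\<^bsub>B3\<^esub> k \<otimes>\<^bsub>B3\<^esub> t"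
    using generator_Garside_power[OF s] by blast
  have c: "s \<in> carrier B3" "t \<in> carrier B3" "x \<in> carrier B3" "\<Delta> [^]\<^bsub>B3\<^esub> k \<in> carrier B3"
    using s t(1) x(2) by (auto simp: cone_in_B3)
  have "s \<otimes>\<^bsub>B3\<^esub> y = \<Delta> [^]\<^bsub>B3\<^esub> k \<otimes>\<^bsub>B3\<^esub> (t \<otimes>\<^bsub>B3\<^esub> x)"
    using c t(2) by (simp add: x(1) flip: B3.m_assoc)
  then show "s \<otimes>\<^bsub>B3\<^esub> y \<in> Garside_cone"
    using t(1) by (simp only: Garside_power_mult_Garside_cone cone)
  have "inv\<^bsub>B3\<^esub> s \<otimes>\<^bsub>B3\<^esub> \<Delta> [^]\<^bsub>B3\<^esub> k = \<Delta> [^]\<^bsub>B3\<^esub> k \<otimes>\<^bsub>B3\<^esub> inv\<^bsub>B3\<^esub> t"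
    using c t(2) by (metis B3.inv_solve_left' B3.inv_solve_right B3.m_assoc B3.inv_closed B3.m_closed)
  then have "inv\<^bsub>B3\<^esub> s \<otimes>\<^bsub>B3\<^esub> y = \<Delta> [^]\<^bsub>B3\<^esub> k \<otimes>\<^bsub>B3\<^esub> (inv\<^bsub>B3\<^esub> t \<otimes>\<^bsub>B3\<^esub> x)"
    using c by (simp add: x(1) flip: B3.m_assoc)
  then show "inv\<^bsub>B3\<^esub> s \<otimes>\<^bsub>B3\<^esub> y \<in> Garside_cone"
    using t(1) by (simp only: Garside_power_mult_Garside_cone cone)
qed

section \<open>From words to normal forms\<close>

lemma word_class_mult:
  "word_class braid_relations u \<otimes>\<^bsub>B3\<^esub> word_class braid_relations v =
    word_class braid_relations (u @ v)"
  by (simp add: B3_def mult_word_class)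

lemma word_class_in_B3: "word_class braid_relations u \<in> carrier B3"
  by (simp add: B3_def carrier_presented_group)

lemma one_B3: "\<one>\<^bsub>B3\<^esub> = word_class braid_relations []"
  by (simp add: B3_def presented_group_def)

lemma word_class_inverse_letter:
  "word_class braid_relations [(x, False)] = inv\<^bsub>B3\<^esub> (word_class braid_relations [(x, True)])"
proof -
  have "word_class braid_relations [(x, False)] \<otimes>\<^bsub>B3\<^esub> word_class braid_relations [(x, True)] =
      \<one>\<^bsub>B3\<^esub>"
    unfolding word_class_mult one_B3 word_class_eq_iff
    using pres_eq.cancel[of _ x False] by simp
  then show ?thesis
    by (simp add: B3.inv_equality word_class_in_B3)
qed

lemma word_class_in_Garside_cone: "word_class braid_relations w \<in> Garside_cone"
proof (induction w)
  case Nil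
  \<comment> \<open>The identity is the zeroth power of sigma2.\<close>
  have "\<sigma>\<^sub>2 [^]\<^bsub>B3\<^esub> (0::int) \<in> Garside_cone"
    by (intro cone_subset_Garside_cone cone.intros)
  then show ?case by (simp add: one_B3)
next
  case (Cons p w)
  obtain x e where p: "p = (x, e)" by (cases p)
  let ?s = "word_class braid_relations [(x, True)]"
  have "?s \<in> {\<sigma>\<^sub>1, \<sigma>\<^sub>2}"
    by (cases x) (auto simp: sigma1_def sigma2_def)
  note closed = generator_mult_Garside_cone[OF this Cons.IH]
  have "word_class braid_relations (p # w) =
      (if e then ?s else inv\<^bsub>B3\<^esub> ?s) \<otimes>\<^bsub>B3\<^esub> word_class braid_relations w"
    by (simp add: p word_class_mult flip: word_class_inverse_letter)
  then show ?case
    using closed by simp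
qed

lemma exists_normal_form:
  assumes "g \<in> carrier B3"
  shows "\<exists>k n a b. normal_form g k n a b"
proof -
  have "g \<in> Garside_cone"
    using assms word_class_in_Garside_cone by (auto simp: B3_def carrier_presented_group)
  then obtain k x where "g = \<Delta> [^]\<^bsub>B3\<^esub> (k::int) \<otimes>\<^bsub>B3\<^esub> x" "x \<in> cone"
    by (auto simp: Garside_cone_def)
  then obtain l where l: "admissible l" "g = \<Delta> [^]\<^bsub>B3\<^esub> k \<otimes>\<^bsub>B3\<^esub> list_product l"
    using cone_eq_list_product by blast
  \<comment> \<open>List positions start at 0 and exponents at 1, hence the shift
    \<open>i - 1\<close>.\<close>
  have "map (\<lambda>i. (fst (l ! (i - 1)), snd (l ! (i - 1)))) [1..<Suc (length l)] = l"
    by (rule nth_equalityI) (simp_all del: upt_Suc)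
  then have "normal_form g k (length l) (\<lambda>i. fst (l ! (i - 1))) (\<lambda>i. snd (l ! (i - 1)))"
    using l unfolding normal_form_iff_admissible by simp
  then show ?thesis by blast
qed


section \<open>Uniqueness\<close>

text \<open>
  The first two coordinates carry the action through \<open>SL\<^sub>2(\<int>)\<close>, the third one counts the
  exponent sum.
\<close>

fun letter_action :: "artin_gen \<times> bool \<Rightarrow> int \<times> int \<times> int \<Rightarrow> int \<times> int \<times> int" where
  "letter_action (S1, True) (x, y, s) = (x + y, y, s + 1)"
| "letter_action (S1, False) (x, y, s) = (x - y, y, s - 1)"
| "letter_action (S2, True) (x, y, s) = (x, y - x, s + 1)"
| "letter_action (S2, False) (x, y, s) = (x, y + x, s - 1)"

abbreviation word_action :: "artin_gen word \<Rightarrow> int \<times> int \<times> int \<Rightarrow> int \<times> int \<times> int" where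
  "word_action w \<equiv> foldr letter_action w"

text \<open>Both sides of the braid relation send (x, y, s) to (y, -x, s + 3), and opposite letters
  act by inverse maps.\<close>

lemma word_action_pres_eq:
  "pres_eq braid_relations u v \<Longrightarrow> word_action u p = word_action v p"
proof (induction arbitrary: p rule: pres_eq.induct)
  case (relation u v)
  then show ?case
    by (cases p) (simp add: braid_relations_def)
next
  case (cancel x e)
  then show ?case
    by (cases p; cases x; cases e) simp_all
qed simp_all

text \<open>The choice of the representative is harmless by
  \<open>word_action_pres_eq\<close>.\<close>

definition B3_action :: "artin_gen word set \<Rightarrow> int \<times> int \<times> int \<Rightarrow> int \<times> int \<times> int" where
  "B3_action g = word_action (SOME w. w \<in> g)"

lemma B3_action_word_class: "B3_action (word_class braid_relations w) = word_action w"
proof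
  fix p
  have "\<exists>v. v \<in> word_class braid_relations w"
    by (auto simp: word_class_def intro: pres_eq.refl)
  then have "(SOME v. v \<in> word_class braid_relations w) \<in> word_class braid_relations w"
    by (rule someI_ex)
  then show "B3_action (word_class braid_relations w) p = word_action w p"
    by (simp add: B3_action_def word_class_def word_action_pres_eq)
qed

lemma B3_action_mult [simp]:
  assumes "g \<in> carrier B3" "h \<in> carrier B3"
  shows "B3_action (g \<otimes>\<^bsub>B3\<^esub> h) p = B3_action g (B3_action h p)"
proof -
  obtain u v where "g = word_class braid_relations u" "h = word_class braid_relations v"
    using assms by (auto simp: B3_def carrier_presented_group)
  then show ?thesis
    by (simp add: word_class_mult B3_action_word_class)
qed

lemma B3_action_one [simp]: "B3_action \<one>\<^bsub>B3\<^esub> p = p"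
  by (simp add: one_B3 B3_action_word_class)

text \<open>Reduces a closed form for all integer powers to its value at 0 and one upward
  recursion.\<close>

lemma B3_action_int_pow:
  assumes g: "g \<in> carrier B3"
    and zero: "\<And>p. F 0 p = p" and step: "\<And>k p. F (k + 1) p = F k (B3_action g p)"
  shows "B3_action (g [^]\<^bsub>B3\<^esub> (k::int)) p = F k p"
proof (induction k arbitrary: p rule: int_induct[where k = 0])
  case base
  show ?case by (simp add: zero)
next
  case (step1 i)
  have "B3_action (g [^]\<^bsub>B3\<^esub> (i + 1)) p = B3_action (g [^]\<^bsub>B3\<^esub> i) (B3_action g p)"
    using g by (simp add: B3.int_pow_mult)
  then show ?case by (simp add: step1 step)
next
  case (step2 i)
  \<comment> \<open>The recursion at \<open>i - 1\<close>, applied to the preimage \<open>?q\<close>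
    of \<open>p\<close> under \<open>g\<close>, gives the downward step.\<close>
  let ?q = "B3_action (inv\<^bsub>B3\<^esub> g) p"
  have q: "B3_action g ?q = p"
    using g by (simp flip: B3_action_mult)
  have "g [^]\<^bsub>B3\<^esub> (i - 1) = g [^]\<^bsub>B3\<^esub> i \<otimes>\<^bsub>B3\<^esub> inv\<^bsub>B3\<^esub> g"
    using g by (simp add: B3.int_pow_diff)
  then have "B3_action (g [^]\<^bsub>B3\<^esub> (i - 1)) p = F i ?q"
    using g by (simp add: step2)
  also have "\<dots> = F (i - 1) p"
    using step[of "i - 1" ?q] by (simp add: q)
  finally show ?case .
qed

lemma B3_action_sigma1_power [simp]:
  "B3_action (\<sigma>\<^sub>1 [^]\<^bsub>B3\<^esub> (a::int)) (x, y, s) = (x + a * y, y, s + a)"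
  by (subst B3_action_int_pow[where F = "\<lambda>a (x, y, s). (x + a * y, y, s + a)"])
    (auto simp: sigma1_def B3_action_word_class word_class_in_B3 algebra_simps)

lemma B3_action_sigma2_power [simp]:
  "B3_action (\<sigma>\<^sub>2 [^]\<^bsub>B3\<^esub> (b::int)) (x, y, s) = (x, y - b * x, s + b)"
  by (subst B3_action_int_pow[where F = "\<lambda>b (x, y, s). (x, y - b * x, s + b)"])
    (auto simp: sigma2_def B3_action_word_class word_class_in_B3 algebra_simps)

lemma B3_action_Garside: "B3_action \<Delta> (x, y, s) = (y, - x, s + 3)"
  by (simp add: Garside_def sigma1_def sigma2_def word_class_mult B3_action_word_class)

text \<open>The effect of Delta^k: \<open>k\<close> clockwise right-angle turns, of period 4, while
  the summand \<open>3 * k\<close> still remembers \<open>k\<close> itself.\<close>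

fun rotate :: "int \<Rightarrow> int \<times> int \<times> int \<Rightarrow> int \<times> int \<times> int" where
  "rotate k (x, y, s) =
    (if k mod 4 = 0 then (x, y, s + 3 * k) else if k mod 4 = 1 then (y, - x, s + 3 * k)
     else if k mod 4 = 2 then (- x, - y, s + 3 * k) else (- y, x, s + 3 * k))"

lemma rotate_add_one: "rotate (k + 1) (x, y, s) = rotate k (y, - x, s + 3)"
proof -
  have "k mod 4 \<in> {0, 1, 2, 3}" by auto
  moreover have "(k + 1) mod 4 = (if k mod 4 = 3 then 0 else k mod 4 + 1)"
    by presburger
  ultimately show ?thesis by auto
qed

lemma B3_action_Garside_power: "B3_action (\<Delta> [^]\<^bsub>B3\<^esub> (k::int)) p = rotate k p"
  by (rule B3_action_int_pow) (auto simp: rotate_add_one B3_action_Garside simp del: rotate.simps, simp)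

section \<open>Images of (0,1) under alternating products\<close>

text \<open>Since sigma2 fixes (0,1), the last pair yields (a, 1). Each earlier pair first increases
  \<open>y\<close>, as \<open>b\<close> is negative, and then adds at least one copy of the new
  \<open>y\<close> to \<open>x\<close>.\<close>

lemma list_product_action_nonempty:
  assumes "l \<noteq> []" "\<forall>p\<in>set l. fst p > 0" "\<forall>p\<in>set (butlast l). snd p < 0"
  shows "\<exists>x y s. B3_action (list_product l) (0, 1, 0) = (x, y, s) \<and> 0 < y \<and> y \<le> x"
  using assms
proof (induction l)
  case Nil
  then show ?case by simp
next
  case (Cons p l)
  obtain a b where p: "p = (a, b)" by (cases p)
  have a: "0 < a" using Cons.prems by (simp add: p)
  show ?case
  proof (cases "l = []")
    case True
    then show ?thesis using a by (simp add: p)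
  next
    case False
    then have b: "b < 0" using Cons.prems by (simp add: p)
    obtain x y s where xy: "B3_action (list_product l) (0, 1, 0) = (x, y, s)" "0 < y" "y \<le> x"
      using Cons False by auto
    have "b * x < 0" using b xy by (simp add: mult_neg_pos)
    then have "0 < y - b * x" using xy by linarith
    \<comment> \<open>This is applied to z = y - b * x.\<close>
    moreover have "z \<le> x + a * z" if "0 < z" for z
    proof -
      have "z \<le> a * z" using a that by simp
      then show ?thesis using xy(2,3) by linarith
    qed
    ultimately show ?thesis
      using xy by (simp add: p)
  qed
qed

text \<open>The point (x, y) belongs to the tail \<open>l\<close>. The last two conclusions make
  \<open>x\<close> a remainder and \<open>a\<close> a quotient on division by y - b * x.\<close>

lemma list_product_action_admissible:
  assumes "admissible ((a, b) # l)"
  obtains x y s where "B3_action (list_product l) (0, 1, 0) = (x, y, s)" "0 < y"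
    "if l = [] then x = 0 \<and> y = 1 else 0 < x \<and> y \<le> x \<and> b < 0" "0 \<le> x" "x < y - b * x"
proof (cases "l = []")
  case True
  then show ?thesis using that[of 0 1 0] by simp
next
  case False
  then have l: "\<forall>p\<in>set l. fst p > 0" "\<forall>p\<in>set (butlast l). snd p < 0" "b < 0"
    using assms by (auto simp: admissible_def)
  obtain x y s where xy: "B3_action (list_product l) (0, 1, 0) = (x, y, s)" "0 < y" "y \<le> x"
    using list_product_action_nonempty[OF False l(1,2)] by blast
  have "1 * x \<le> (- b) * x"
    using l(3) xy by (intro mult_right_mono) auto
  then show ?thesis
    using that[OF xy(1,2)] xy False l(3) by simp
qed

text \<open>Nontrivial turns by right angles move this half-open quadrant off itself, which will
  determine \<open>k\<close> modulo 4.\<close>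

lemma list_product_action_quadrant:
  assumes "admissible l"
  obtains x y s where "B3_action (list_product l) (0, 1, 0) = (x, y, s)" "0 \<le> x" "0 < y"
proof -
  obtain a b t where t: "l = (a, b) # t"
    using assms by (metis admissible_def neq_Nil_conv surj_pair)
  have a: "0 \<le> a" using assms by (simp add: t admissible_def)
  obtain x y s where "B3_action (list_product t) (0, 1, 0) = (x, y, s)" "0 < y"
    "if t = [] then x = 0 \<and> y = 1 else 0 < x \<and> y \<le> x \<and> b < 0" "0 \<le> x" "x < y - b * x"
    using list_product_action_admissible[OF assms[unfolded t]] .
  then show ?thesis
    using that[of "x + a * (y - b * x)" "y - b * x" "s + b + a"] a by (simp add: t)
qed

section \<open>Recovering the exponents by division with remainder\<close>

text \<open>Both sides divide the same number by the same divisor, with quotients \<open>a\<close>,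
  \<open>a'\<close> and remainders \<open>x\<close>, \<open>x'\<close>.\<close>

lemma euclid_step_unique:
  fixes a a' b b' x x' y y' :: int
  assumes "x + a * (y - b * x) = x' + a' * (y' - b' * x')" "y - b * x = y' - b' * x'"
    and "0 \<le> x" "x < y - b * x" "0 \<le> x'" "x' < y' - b' * x'"
  shows "a = a'" "x = x'"
proof -
  define z where "z = y - b * x"
  have eq: "x + a * z = x' + a' * z" "x < z" "x' < z"
    using assms by (simp_all add: z_def)
  have "(x + a * z) div z = a" "(x' + a' * z) div z = a'"
    using assms(3,5) eq(2,3) by simp_all
  then show "a = a'" by (metis eq(1))
  then show "x = x'" using eq by simp
qed

lemma offset_unique:
  fixes b b' x y y' :: int
  assumes "y - b * x = y' - b' * x" "0 < y" "y \<le> x" "0 < y'" "y' \<le> x"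
  shows "b = b'" "y = y'"
proof -
  \<comment> \<open>As \<open>y\<close> ranges over 1 to \<open>x\<close>, the remainder modulo
    \<open>x\<close> to use is \<open>x - y\<close>.\<close>
  have "(x - y) + b * x = (x - y') + b' * x" using assms by simp
  moreover have "((x - y) + b * x) div x = b" "((x - y') + b' * x) div x = b'"
    using assms by simp_all
  ultimately show "b = b'" by metis
  then show "y = y'" using assms by simp
qed

text \<open>The image of (0,1) yields every exponent but the last, which sigma2 hides by fixing
  (0,1); the image of (1,0) reveals it. The third coordinates are kept independent because
  \<open>k - k'\<close> is known only modulo 4 when this is applied.\<close>

lemma list_product_action_unique:
  assumes "admissible l" "admissible l'"
    and "B3_action (list_product l) (0, 1, 0) = (x, y, s)"
    and "B3_action (list_product l') (0, 1, 0) = (x, y, s')"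
    and "B3_action (list_product l) (1, 0, 0) = (u, v, r)"
    and "B3_action (list_product l') (1, 0, 0) = (u, v, r')"
  shows "l = l'"
  using assms
proof (induction l arbitrary: l' x y s s' u v r r')
  case Nil
  then show ?case by (simp add: admissible_def)
next
  case (Cons p t)
  obtain a b where p: "p = (a, b)" by (cases p)
  obtain a' b' t' where l': "l' = (a', b') # t'"
    using Cons.prems(2) by (metis admissible_def neq_Nil_conv surj_pair)
  obtain x1 y1 s1 where xy: "B3_action (list_product t) (0, 1, 0) = (x1, y1, s1)" "0 < y1"
    "if t = [] then x1 = 0 \<and> y1 = 1 else 0 < x1 \<and> y1 \<le> x1 \<and> b < 0" "0 \<le> x1" "x1 < y1 - b * x1"
    using list_product_action_admissible[OF Cons.prems(1)[unfolded p]] .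
  obtain x2 y2 s2 where xy': "B3_action (list_product t') (0, 1, 0) = (x2, y2, s2)" "0 < y2"
    "if t' = [] then x2 = 0 \<and> y2 = 1 else 0 < x2 \<and> y2 \<le> x2 \<and> b' < 0" "0 \<le> x2" "x2 < y2 - b' * x2"
    using list_product_action_admissible[OF Cons.prems(2)[unfolded l']] .
  obtain u1 v1 r1 where uv: "B3_action (list_product t) (1, 0, 0) = (u1, v1, r1)"
    by (metis surj_pair)
  obtain u2 v2 r2 where uv': "B3_action (list_product t') (1, 0, 0) = (u2, v2, r2)"
    by (metis surj_pair)
  have eq: "x1 + a * (y1 - b * x1) = x2 + a' * (y2 - b' * x2)" "y1 - b * x1 = y2 - b' * x2"
    "u1 + a * (v1 - b * u1) = u2 + a' * (v2 - b' * u2)" "v1 - b * u1 = v2 - b' * u2"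
    using Cons.prems(3-6) xy(1) xy'(1) uv uv' by (auto simp: p l')
  have a: "a = a'" and x: "x1 = x2"
    using euclid_step_unique[OF eq(1,2) xy(4,5) xy'(4,5)] by auto
  have u: "u1 = u2" using eq(3,4) by (simp add: a)
  show ?case
  proof (cases "t = []")
    case True
    \<comment> \<open>An empty tail gives first coordinate 0 and a nonempty one a positive value, so
      both lists end together.\<close>
    then have t': "t' = []" using x xy(3) xy'(3) by (auto split: if_splits)
    \<comment> \<open>Both tails now fix (1,0), so \<open>eq(4)\<close> reads - b = - b'.\<close>
    then have "b = b'" using True uv uv' eq(4) by simp
    then show ?thesis by (simp add: p l' a True t')
  next
    case False
    then have t': "t' \<noteq> []" using x xy(3) xy'(3) by (auto split: if_splits)
    have b: "b = b'" and y: "y1 = y2"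
      using offset_unique[of y1 b x1 y2 b'] eq(2) xy xy' x False t' by auto
    have "v1 = v2" using eq(4) by (simp add: b u)
    moreover have "admissible t" "admissible t'"
      using Cons.prems(1,2) False t'
      by (auto simp: admissible_def p l' hd_in_set less_imp_le dest: list.set_sel(2))
    ultimately have "t = t'"
      using Cons.IH[of t' x1 y1 s1 s2 u1 v1 r1 r2] xy(1) xy'(1) uv uv' x y u by simp
    then show ?thesis by (simp add: p l' a b)
  qed
qed

text \<open>Delta^(k - k') carries one point of the quadrant to another, so it turns by a multiple
  of a full circle. The lists then act equally on the plane and coincide.\<close>

lemma Garside_power_list_product_unique:
  assumes "admissible l" "admissible l'"
    and eq: "\<Delta> [^]\<^bsub>B3\<^esub> (k::int) \<otimes>\<^bsub>B3\<^esub> list_product l =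
      \<Delta> [^]\<^bsub>B3\<^esub> (k'::int) \<otimes>\<^bsub>B3\<^esub> list_product l'"
  shows "k = k'" "l = l'"
proof -
  let ?d = "k - k'"
  have "\<Delta> [^]\<^bsub>B3\<^esub> ?d \<otimes>\<^bsub>B3\<^esub> list_product l = list_product l'"
  proof -
    have "\<Delta> [^]\<^bsub>B3\<^esub> ?d \<otimes>\<^bsub>B3\<^esub> list_product l =
        \<Delta> [^]\<^bsub>B3\<^esub> (- k' + k) \<otimes>\<^bsub>B3\<^esub> list_product l"
      by simp
    also have "\<dots> = \<Delta> [^]\<^bsub>B3\<^esub> (- k') \<otimes>\<^bsub>B3\<^esub> (\<Delta> [^]\<^bsub>B3\<^esub> k \<otimes>\<^bsub>B3\<^esub> list_product l)"
      unfolding B3.int_pow_mult[OF Garside_in_B3] by (rule B3.m_assoc) simp_all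
    also have "\<dots> = list_product l'"
      unfolding eq by (simp add: B3.int_pow_neg flip: B3.m_assoc)
    finally show ?thesis .
  qed
  then have action: "B3_action (list_product l') p = rotate ?d (B3_action (list_product l) p)" for p
    by (metis B3_action_Garside_power B3_action_mult B3.int_pow_closed Garside_in_B3
        list_product_in_B3)
  obtain x y s where xy: "B3_action (list_product l) (0, 1, 0) = (x, y, s)" "0 \<le> x" "0 < y"
    using list_product_action_quadrant[OF assms(1)] .
  obtain x' y' s' where xy': "B3_action (list_product l') (0, 1, 0) = (x', y', s')" "0 \<le> x'" "0 < y'"
    using list_product_action_quadrant[OF assms(2)] .
  obtain u v r where uv: "B3_action (list_product l) (1, 0, 0) = (u, v, r)"
    by (metis surj_pair)
  have d: "?d mod 4 = 0" and xy_eq: "x' = x" "y' = y"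
    using action[of "(0, 1, 0)"] xy xy' by (auto split: if_splits)
  have "B3_action (list_product l') (1, 0, 0) = (u, v, r + 3 * ?d)"
    using action[of "(1, 0, 0)"] d by (simp add: uv)
  then show l: "l = l'"
    using list_product_action_unique[OF assms(1,2) xy(1) _ uv] xy'(1) by (simp add: xy_eq)
  \<comment> \<open>With equal lists the third coordinates agree, yet they differ by
    \<open>3 * ?d\<close>.\<close>
  show "k = k'"
    using action[of "(0, 1, 0)"] xy xy' d by (simp add: l)
qed

theorem theorem1p2:
  assumes "g \<in> carrier B3"
  shows "(\<exists>k n a b. normal_form g k n a b) \<and>
    (\<forall>k n a b k' n' a' b'. normal_form g k n a b \<and> normal_form g k' n' a' b' \<longrightarrow>
       k = k' \<and> n = n' \<and> (\<forall>i\<in>{1..n}. a i = a' i \<and> b i = b' i))"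
proof (intro conjI allI impI)
  show "\<exists>k n a b. normal_form g k n a b"
    using assms by (rule exists_normal_form)
next
  fix k n a b k' n' a' b'
  assume nf: "normal_form g k n a b \<and> normal_form g k' n' a' b'"
  \<comment> \<open>These lists record the exponents on 1 to n only, exactly the data claimed to be
    unique.\<close>
  let ?l = "map (\<lambda>i. (a i, b i)) [1..<Suc n]"
  let ?l' = "map (\<lambda>i. (a' i, b' i)) [1..<Suc n']"
  have "k = k' \<and> ?l = ?l'"
    using nf Garside_power_list_product_unique[of ?l ?l' k k']
    unfolding normal_form_iff_admissible by metis
  then have l: "k = k'" "?l = ?l'" by blast+
  then show "k = k'" by simp
  have "length ?l = length ?l'" by (simp only: l(2))
  then show n: "n = n'" by (simp del: upt_Suc)
  show "\<forall>i\<in>{1..n}. a i = a' i \<and> b i = b' i"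
    using l(2) n by (auto simp del: upt_Suc)
qed

end
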